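(* Let $X$ be an irreducible continuous-time Markov process on a finite set $\mathcal{X}$ with kernel $p$, reversible with respect to the probability measure $\mu$, and let $\mathcal{R}\subset\mathcal{X}$ be such that the restricted processes $X_{\mathcal{R}}$ and $X_{\mathcal{X}\setminus\mathcal{R}}$ are irreducible. Then for all $\kappa>0$, $$\frac{C_\kappa(\mathcal{R},\mathcal{X}\setminus\mathcal{R})}{\mu(\mathcal{R})}\left\{1-\varepsilon_{\mathcal{R}}^*-\frac{\kappa}{\gamma_{\mathcal{R}}}\right\}\le\phi_{\mathcal{R}}^*\le\frac{C_\kappa(\mathcal{R},\mathcal{X}\setminus\mathcal{R})}{\mu(\mathcal{R})}\left\{1-\frac{C_\kappa(\mathcal{R},\mathcal{X}\setminus\mathcal{R})}{\kappa\,\mu(\mathcal{R})}\right\}^{-2}.$$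
   Context: $X$ has generator $\mathcal{L}f(x)=\sum_{y\in\mathcal{X}}p(x,y)(f(y)-f(x))$ with $p\ge 0$, $\sum_y p(x,y)=1$; $\mu(x)p(x,y)=\mu(y)p(y,x)=:c(x,y)$. Dirichlet form: $\mathcal{D}(f)=\frac12\sum_{x,y\in\mathcal{X}}c(x,y)(f(x)-f(y))^2$. $\mathcal{R}$ is a nonempty proper subset with at least two elements. For $x\in\mathcal{R}$, $e_{\mathcal{R}}(x)=\sum_{y\notin\mathcal{R}}p(x,y)$. The restricted process $X_{\mathcal{R}}$ on $\mathcal{R}$ has generator $f\mapsto\sum_{y\in\mathcal{R}}p_{\mathcal{R}}(x,y)(f(y)-f(x))$ with $p_{\mathcal{R}}(x,y)=p(x,y)$ for $x\ne y$ and $p_{\mathcal{R}}(x,x)=p(x,x)+e_{\mathcal{R}}(x)$ (similarly $X_{\mathcal{X}\setminus\mathcal{R}}$); it is reversible with respect to $\mu_{\mathcal{R}}=\mu(\cdot\mid\mathcal{R})$. Its spectral gap is $\gamma_{\mathcal{R}}=\min_{\mathrm{Var}_{\mu_{\mathcal{R}}}(f)\ne0}\mathcal{D}_{\mathcal{R}}(f)/\mathrm{Var}_{\mu_{\mathcal{R}}}(f)$ with $\mathcal{D}_{\mathcal{R}}(f)=\frac12\sum_{x,y\in\mathcal{R}}\mu_{\mathcal{R}}(x)p_{\mathcal{R}}(x,y)(f(x)-f(y))^2$. Let $p^*_{\mathcal{R}}(x,y)=p(x,y)$ for $x,y\in\mathcal{R}$ (sub-Markovian kernel) and let $1-\phi^*_{\mathcal{R}}$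 be its spectral radius; set $\varepsilon^*_{\mathcal{R}}=\phi^*_{\mathcal{R}}/\gamma_{\mathcal{R}}$. The $\kappa$-capacity is $$C_\kappa(\mathcal{R},\mathcal{X}\setminus\mathcal{R})=\min\Big\{\mathcal{D}(f)+\kappa\sum_{a\in\mathcal{R}}\mu(a)(f(a)-1)^2:\ f:\mathcal{X}\to\mathbb{R},\ f|_{\mathcal{X}\setminus\mathcal{R}}=0\Big\}.$$ *)

theory Defs
  imports Complex_Main "HOL-Library.Countable_Set" "Jordan_Normal_Form.Spectral_Radius"
begin

text \<open>
  A finite state space is a finite set \<open>S :: 'a set\<close>; kernels \<open>p :: 'a \<Rightarrow> 'a \<Rightarrow> real\<close>, weights
  \<open>\<mu> :: 'a \<Rightarrow> real\<close> and functions \<open>f :: 'a \<Rightarrow> real\<close> are total functions of which only the values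
  on \<open>S\<close> matter.  A continuous-time Markov process on \<open>S\<close> is given by the kernel \<open>p\<close> of its
  generator \<open>f \<mapsto> (\<lambda>x. \<Sum>y\<in>S. p x y * (f y - f x))\<close>.
\<close>

definition markov_kernel :: "'a set \<Rightarrow> ('a \<Rightarrow> 'a \<Rightarrow> real) \<Rightarrow> bool" where
  "markov_kernel S p \<longleftrightarrow>
     (\<forall>x\<in>S. \<forall>y\<in>S. 0 \<le> p x y) \<and> (\<forall>x\<in>S. (\<Sum>y\<in>S. p x y) = 1)"

definition prob_weights :: "'a set \<Rightarrow> ('a \<Rightarrow> real) \<Rightarrow> bool" where
  "prob_weights S \<mu> \<longleftrightarrow> (\<forall>x\<in>S. 0 \<le> \<mu> x) \<and> (\<Sum>x\<in>S. \<mu> x) = 1"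

definition reversible_wrt :: "'a set \<Rightarrow> ('a \<Rightarrow> 'a \<Rightarrow> real) \<Rightarrow> ('a \<Rightarrow> real) \<Rightarrow> bool" where
  "reversible_wrt S p \<mu> \<longleftrightarrow> (\<forall>x\<in>S. \<forall>y\<in>S. \<mu> x * p x y = \<mu> y * p y x)"

definition irreducible_on :: "'a set \<Rightarrow> ('a \<Rightarrow> 'a \<Rightarrow> real) \<Rightarrow> bool" where
  "irreducible_on S p \<longleftrightarrow>
     (\<forall>x\<in>S. \<forall>y\<in>S. (x, y) \<in> {(a, b). a \<in> S \<and> b \<in> S \<and> 0 < p a b}\<^sup>*)"

definition dirichlet_form ::
  "'a set \<Rightarrow> ('a \<Rightarrow> 'a \<Rightarrow> real) \<Rightarrow> ('a \<Rightarrow> real) \<Rightarrow> ('a \<Rightarrow> real) \<Rightarrow> real" where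
  "dirichlet_form S p \<mu> f = 1 / 2 * (\<Sum>x\<in>S. \<Sum>y\<in>S. \<mu> x * p x y * (f x - f y)\<^sup>2)"

definition mean_on :: "'a set \<Rightarrow> ('a \<Rightarrow> real) \<Rightarrow> ('a \<Rightarrow> real) \<Rightarrow> real" where
  "mean_on S \<mu> f = (\<Sum>x\<in>S. \<mu> x * f x)"

definition variance_on :: "'a set \<Rightarrow> ('a \<Rightarrow> real) \<Rightarrow> ('a \<Rightarrow> real) \<Rightarrow> real" where
  "variance_on S \<mu> f = mean_on S \<mu> (\<lambda>x. (f x - mean_on S \<mu> f)\<^sup>2)"

text \<open>
  The minima defining the spectral gap and the capacity are written with \<^const>\<open>Inf\<close>, which returns the
  minimum whenever it is attained.
\<close>

definition spectral_gap :: "'a set \<Rightarrow> ('a \<Rightarrow> 'a \<Rightarrow> real) \<Rightarrow> ('a \<Rightarrow> real) \<Rightarrow> real" where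
  "spectral_gap S p \<mu> =
     Inf {dirichlet_form S p \<mu> f / variance_on S \<mu> f | f. variance_on S \<mu> f \<noteq> 0}"

definition escape_prob :: "'a set \<Rightarrow> ('a \<Rightarrow> 'a \<Rightarrow> real) \<Rightarrow> 'a set \<Rightarrow> 'a \<Rightarrow> real" where
  "escape_prob X p R x = (\<Sum>y\<in>X - R. p x y)"

definition restricted_kernel ::
  "'a set \<Rightarrow> ('a \<Rightarrow> 'a \<Rightarrow> real) \<Rightarrow> 'a set \<Rightarrow> 'a \<Rightarrow> 'a \<Rightarrow> real" where
  "restricted_kernel X p R x y = (if x = y then p x x + escape_prob X p R x else p x y)"

definition cond_weights :: "('a \<Rightarrow> real) \<Rightarrow> 'a set \<Rightarrow> 'a \<Rightarrow> real" where
  "cond_weights \<mu> R x = (if x \<in> R then \<mu> x / (\<Sum>a\<in>R. \<mu> a) else 0)"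

definition restricted_gap ::
  "'a set \<Rightarrow> ('a \<Rightarrow> 'a \<Rightarrow> real) \<Rightarrow> ('a \<Rightarrow> real) \<Rightarrow> 'a set \<Rightarrow> real" where
  "restricted_gap X p \<mu> R = spectral_gap R (restricted_kernel X p R) (cond_weights \<mu> R)"

text \<open>
  The kernel \<open>(p x y)\<close>, \<open>x, y \<in> R\<close>, as a complex matrix.  The enumeration of \<open>R\<close> is immaterial:
  another one conjugates the matrix by a permutation, and \<open>eigenvalue_kernel_mat\<close> below describes
  the eigenvalues without it.
\<close>

definition kernel_mat :: "'a set \<Rightarrow> ('a \<Rightarrow> 'a \<Rightarrow> real) \<Rightarrow> complex mat" where
  "kernel_mat R p =
     mat (card R) (card R) (\<lambda>(i, j). complex_of_real (p (from_nat_into R i) (from_nat_into R j)))"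

definition phi_star :: "('a \<Rightarrow> 'a \<Rightarrow> real) \<Rightarrow> 'a set \<Rightarrow> real" where
  "phi_star p R = 1 - spectral_radius (kernel_mat R p)"

definition eps_star ::
  "'a set \<Rightarrow> ('a \<Rightarrow> 'a \<Rightarrow> real) \<Rightarrow> ('a \<Rightarrow> real) \<Rightarrow> 'a set \<Rightarrow> real" where
  "eps_star X p \<mu> R = phi_star p R / restricted_gap X p \<mu> R"

text \<open>\<open>C\<^sub>\<kappa>(R, X - R)\<close>.\<close>

definition kappa_capacity ::
  "'a set \<Rightarrow> ('a \<Rightarrow> 'a \<Rightarrow> real) \<Rightarrow> ('a \<Rightarrow> real) \<Rightarrow> real \<Rightarrow> 'a set \<Rightarrow> real" where
  "kappa_capacity X p \<mu> \<kappa> R =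
     Inf {dirichlet_form X p \<mu> f + \<kappa> * (\<Sum>a\<in>R. \<mu> a * (f a - 1)\<^sup>2) | f. \<forall>x\<in>X - R. f x = 0}"

lemma eigenvalue_kernel_mat:
  assumes "finite R"
  shows "eigenvalue (kernel_mat R p) k \<longleftrightarrow>
    (\<exists>f. (\<exists>x\<in>R. f x \<noteq> 0) \<and> (\<forall>x\<in>R. (\<Sum>y\<in>R. complex_of_real (p x y) * f y) = k * f x))"
proof -
  let ?n = "card R" and ?e = "from_nat_into R"
  have bij: "bij_betw ?e {..<?n} R"
    using assms by (rule bij_betw_from_nat_into_finite)
  have eR: "?e i \<in> R" if "i < ?n" for i
    using bij that by (auto dest: bij_betwE)
  have ex: "\<exists>i<?n. ?e i = x" if "x \<in> R" for x
    using bij that by (metis bij_betw_imp_surj_on imageE lessThan_iff)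
  have mult: "(kernel_mat R p *\<^sub>v v) $ i
      = (\<Sum>j<?n. complex_of_real (p (?e i) (?e j)) * v $ j)"
    if "v \<in> carrier_vec ?n" "i < ?n" for v i
    using that by (auto simp: kernel_mat_def scalar_prod_def atLeast0LessThan intro!: sum.cong)
  have dims: "dim_row (kernel_mat R p) = ?n" "dim_col (kernel_mat R p) = ?n"
    by (simp_all add: kernel_mat_def)
  have reindex: "(\<Sum>y\<in>R. g y) = (\<Sum>j<?n. g (?e j))" for g :: "'a \<Rightarrow> complex"
    using sum.reindex_bij_betw[OF bij, of g] by simp
  show ?thesis
  proof
    assume "eigenvalue (kernel_mat R p) k"
    then obtain v where v: "v \<in> carrier_vec ?n" "v \<noteq> 0\<^sub>v ?n" "kernel_mat R p *\<^sub>v v = k \<cdot>\<^sub>v v"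
      by (auto simp: eigenvalue_def eigenvector_def dims)
    define f where "f = (\<lambda>x. v $ the_inv_into {..<?n} ?e x)"
    have fe: "f (?e i) = v $ i" if "i < ?n" for i
      using that bij by (simp add: f_def bij_betw_def the_inv_into_f_f)
    obtain i where "i < ?n" "v $ i \<noteq> 0"
      using v(1,2) by (metis eq_vecI carrier_vecD index_zero_vec(1,2))
    then have "\<exists>x\<in>R. f x \<noteq> 0" using fe eR by metis
    moreover have "(\<Sum>y\<in>R. complex_of_real (p x y) * f y) = k * f x" if x: "x \<in> R" for x
    proof -
      obtain i where i: "i < ?n" "?e i = x" using ex[OF x] by blast
      have "(kernel_mat R p *\<^sub>v v) $ i = k * v $ i" using v(1,3) i by simp
      then show ?thesis using mult[OF v(1) i(1)] i fe fe[OF i(1)] by (simp add: reindex)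
    qed
    ultimately show "\<exists>f. (\<exists>x\<in>R. f x \<noteq> 0) \<and>
        (\<forall>x\<in>R. (\<Sum>y\<in>R. complex_of_real (p x y) * f y) = k * f x)" by blast
  next
    assume "\<exists>f. (\<exists>x\<in>R. f x \<noteq> 0) \<and>
        (\<forall>x\<in>R. (\<Sum>y\<in>R. complex_of_real (p x y) * f y) = k * f x)"
    then obtain f x where f: "x \<in> R" "f x \<noteq> 0"
      "\<forall>x\<in>R. (\<Sum>y\<in>R. complex_of_real (p x y) * f y) = k * f x" by blast
    define v where "v = vec ?n (\<lambda>i. f (?e i))"
    have vc: "v \<in> carrier_vec ?n" by (simp add: v_def)
    obtain i where i: "i < ?n" "?e i = x" using ex[OF f(1)] by blast
    have "v $ i \<noteq> 0" using i f(2) by (simp add: v_def)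
    then have "v \<noteq> 0\<^sub>v ?n" using i by auto
    moreover have "kernel_mat R p *\<^sub>v v = k \<cdot>\<^sub>v v"
    proof (rule eq_vecI)
      fix j assume "j < dim_vec (k \<cdot>\<^sub>v v)"
      then have j: "j < ?n" by (simp add: v_def)
      have "(kernel_mat R p *\<^sub>v v) $ j = (\<Sum>l<?n. complex_of_real (p (?e j) (?e l)) * f (?e l))"
        unfolding mult[OF vc j] by (simp add: v_def)
      also have "\<dots> = k * f (?e j)" using f(3) eR[OF j] by (simp add: reindex)
      finally show "(kernel_mat R p *\<^sub>v v) $ j = (k \<cdot>\<^sub>v v) $ j" using j by (simp add: v_def)
    qed (simp add: dims v_def)
    ultimately show "eigenvalue (kernel_mat R p) k"
      using vc by (auto simp: eigenvalue_def eigenvector_def dims)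
  qed
qed

end

theory Submission
  imports Defs "HOL-Analysis.Function_Topology"
begin

text \<open>
  Reversibility makes \<open>\<phi>\<close>, the number \<open>\<phi>\<^sup>*\<close> of \<open>R\<close>, the least Rayleigh quotient
  \<open>D f / \<Sum>\<^sub>R \<mu> f\<^sup>2\<close> over functions \<open>f\<close> vanishing outside \<open>R\<close>.  Put \<open>c = C\<^sub>\<kappa> / \<mu>(R)\<close> and let \<open>E\<close> be
  the expectation under \<open>\<mu>\<^sub>R\<close>.

  Upper bound: since \<open>E f\<^sup>2 \<ge> (E f)\<^sup>2\<close>, the functional minimized in \<open>c\<close> is at least
  \<open>\<phi> s\<^sup>2 + \<kappa> (1 - s)\<^sup>2 \<ge> \<phi> \<kappa> / (\<phi> + \<kappa>)\<close> with \<open>s = E f\<close>.  Hence \<open>\<phi> (1 - c / \<kappa>) \<le> c\<close>, and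
  \<open>0 < 1 - c / \<kappa> \<le> 1\<close>.

  Lower bound: use a minimizer \<open>h\<close> of the Rayleigh quotient, normalized by \<open>E h = 1\<close>, as a test
  function for \<open>c\<close>.  The Poincare inequality on \<open>R\<close> gives \<open>Var h \<le> \<epsilon> E h\<^sup>2\<close>, hence
  \<open>(1 - \<epsilon>) E h\<^sup>2 \<le> 1\<close> and \<open>c \<le> \<phi> (1 + \<kappa> / \<gamma>) / (1 - \<epsilon>)\<close>.
\<close>

text \<open>This is the inner product, in the L^2 space of \<mu> on \<open>S\<close>, of
  \<open>f\<close> with the image of \<open>g\<close> under the kernel. Reversibility makes it
  symmetric, so Rayleigh quotients control the spectrum.\<close>

definition kernel_form ::
  "'a set \<Rightarrow> ('a \<Rightarrow> 'a \<Rightarrow> real) \<Rightarrow> ('a \<Rightarrow> real) \<Rightarrow> ('a \<Rightarrow> real) \<Rightarrow> ('a \<Rightarrow> real) \<Rightarrow> real" where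
  "kernel_form S p \<mu> f g = (\<Sum>x\<in>S. \<Sum>y\<in>S. \<mu> x * p x y * f x * g y)"

definition sq_norm_on :: "'a set \<Rightarrow> ('a \<Rightarrow> real) \<Rightarrow> ('a \<Rightarrow> real) \<Rightarrow> real" where
  "sq_norm_on S \<mu> f = (\<Sum>x\<in>S. \<mu> x * (f x)\<^sup>2)"

section \<open>Quadratic forms in weighted L^2\<close>

lemma sq_norm_on_nonneg:
  assumes "\<And>x. x \<in> S \<Longrightarrow> 0 \<le> \<mu> x"
  shows "0 \<le> sq_norm_on S \<mu> f"
  unfolding sq_norm_on_def using assms by (intro sum_nonneg) auto

lemma sq_norm_on_pos:
  assumes "finite S" "\<And>x. x \<in> S \<Longrightarrow> 0 < \<mu> x" "x \<in> S" "f x \<noteq> 0"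
  shows "0 < sq_norm_on S \<mu> f"
proof -
  have "0 < \<mu> x * (f x)\<^sup>2" using assms by simp
  also have "\<dots> \<le> sq_norm_on S \<mu> f" unfolding sq_norm_on_def
    using assms by (intro member_le_sum) (auto simp: less_imp_le)
  finally show ?thesis .
qed

lemma sq_norm_on_scale: "sq_norm_on S \<mu> (\<lambda>x. t * f x) = t\<^sup>2 * sq_norm_on S \<mu> f"
  by (simp add: sq_norm_on_def power_mult_distrib sum_distrib_left mult_ac)

lemma kernel_form_scale: "kernel_form S p \<mu> (\<lambda>x. t * f x) (\<lambda>x. t * f x) = t\<^sup>2 * kernel_form S p \<mu> f f"
  by (simp add: kernel_form_def power2_eq_square sum_distrib_left mult_ac)

lemma kernel_form_commute:
  assumes "reversible_wrt S p \<mu>"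
  shows "kernel_form S p \<mu> f g = kernel_form S p \<mu> g f"
proof -
  have "kernel_form S p \<mu> f g = (\<Sum>y\<in>S. \<Sum>x\<in>S. \<mu> x * p x y * f x * g y)"
    unfolding kernel_form_def by (rule sum.swap)
  also have "\<dots> = kernel_form S p \<mu> g f"
    unfolding kernel_form_def
  proof (intro sum.cong refl)
    fix x y assume "x \<in> S" "y \<in> S"
    then have "\<mu> y * p y x = \<mu> x * p x y" using assms by (auto simp: reversible_wrt_def)
    then show "\<mu> y * p y x * f y * g x = \<mu> x * p x y * g x * f y" by simp
  qed
  finally show ?thesis .
qed

text \<open>Along a line the form is a quadratic polynomial in \<open>t\<close>; its linear
  coefficient supplies the first-order condition at a maximizer. Symmetry merges the two cross
  terms.\<close>

lemma kernel_form_perturb: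
  assumes "reversible_wrt S p \<mu>"
  shows "kernel_form S p \<mu> (\<lambda>x. f x + t * g x) (\<lambda>x. f x + t * g x)
    = kernel_form S p \<mu> f f + 2 * t * kernel_form S p \<mu> g f + t\<^sup>2 * kernel_form S p \<mu> g g"
proof -
  have "kernel_form S p \<mu> (\<lambda>x. f x + t * g x) (\<lambda>x. f x + t * g x)
    = kernel_form S p \<mu> f f + t * kernel_form S p \<mu> f g + t * kernel_form S p \<mu> g f
      + t\<^sup>2 * kernel_form S p \<mu> g g"
    unfolding kernel_form_def sum_distrib_left sum.distrib[symmetric]
    by (intro sum.cong refl) (simp add: algebra_simps power2_eq_square)
  then show ?thesis using kernel_form_commute[OF assms, of f g] by simp
qed

lemma sq_norm_on_perturb:
  "sq_norm_on S \<mu> (\<lambda>x. f x + t * g x)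
    = sq_norm_on S \<mu> f + 2 * t * (\<Sum>x\<in>S. \<mu> x * g x * f x) + t\<^sup>2 * sq_norm_on S \<mu> g"
  unfolding sq_norm_on_def sum_distrib_left sum.distrib[symmetric]
  by (intro sum.cong refl) (simp add: algebra_simps power2_eq_square)

section \<open>Existence of a maximizer of the Rayleigh quotient\<close>

lemma compact_PiE_UNIV:
  fixes B :: "'a \<Rightarrow> 'b :: topological_space set"
  assumes "\<And>x. compact (B x)"
  shows "compact (PiE UNIV B)"
proof -
  have "compactin (product_topology (\<lambda>x. euclidean) UNIV) (PiE UNIV B)"
    using assms by (simp add: compactin_PiE compactin_euclidean_iff)
  then show ?thesis by (simp add: euclidean_product_topology compactin_euclidean_iff)
qed

text \<open>A continuous function attains its supremum on the compact unit sphere, and homogeneity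
  carries the bound from there to every \<open>g\<close>. Compactness is that of the product
  topology on total functions, by Tychonoff.\<close>

lemma rayleigh_maximizer:
  fixes S :: "'a set" and p :: "'a \<Rightarrow> 'a \<Rightarrow> real" and \<mu> :: "'a \<Rightarrow> real"
  assumes fin: "finite S" and ne: "S \<noteq> {}" and pos: "\<And>x. x \<in> S \<Longrightarrow> 0 < \<mu> x"
  obtains h where "sq_norm_on S \<mu> h = 1"
    "\<And>g. kernel_form S p \<mu> g g \<le> kernel_form S p \<mu> h h * sq_norm_on S \<mu> g"
proof -
  \<comment> \<open>Unit norm forces \<open>(f x)\<^sup>2\<close> \<le> \<open>1 / \<mu> x\<close>,
    and i \<le> (1 + i)^2 turns this into an interval without a square root. Outside
    \<open>S\<close> the coordinate is pinned to 0, so that all factors are compact even over an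
    infinite type.\<close>
  define B where "B = (\<lambda>x. if x \<in> S then {- (1 + 1 / \<mu> x)..1 + 1 / \<mu> x} else {0})"
  define K where "K = PiE UNIV B \<inter> {f. sq_norm_on S \<mu> f = 1}"
  have coord: "continuous_on UNIV (\<lambda>f :: 'a \<Rightarrow> real. f x)" for x
    by (rule continuous_on_product_coordinates)
  have cs: "continuous_on UNIV (\<lambda>f. sq_norm_on S \<mu> f)"
    unfolding sq_norm_on_def by (intro continuous_intros coord)
  have ck: "continuous_on UNIV (\<lambda>f. kernel_form S p \<mu> f f)"
    unfolding kernel_form_def by (intro continuous_intros coord)
  have "compact (PiE UNIV B)" by (rule compact_PiE_UNIV) (auto simp: B_def)
  moreover have "closed {f. sq_norm_on S \<mu> f = 1}"
    by (rule closed_Collect_eq) (use cs in auto)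
  ultimately have cK: "compact K" unfolding K_def by (rule compact_Int_closed)
  have le_sq: "i \<le> (1 + i)\<^sup>2" if "0 \<le> i" for i :: real
    using that zero_le_power2[of i] by (simp add: power2_sum)
  \<comment> \<open>Setting a function to zero outside \<open>S\<close> changes neither form, so
    each unit function has a representative in \<open>K\<close>.\<close>
  have inK: "(\<lambda>x. if x \<in> S then f x else 0) \<in> K" if f: "sq_norm_on S \<mu> f = 1" for f
  proof -
    have "f x \<in> {- (1 + 1 / \<mu> x)..1 + 1 / \<mu> x}" if x: "x \<in> S" for x
    proof -
      have m: "0 < \<mu> x" using pos x by simp
      have "\<mu> x * (f x)\<^sup>2 \<le> sq_norm_on S \<mu> f" unfolding sq_norm_on_def
        using fin pos x by (intro member_le_sum) (auto simp: less_imp_le)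
      then have "(f x)\<^sup>2 \<le> 1 / \<mu> x" using f m by (simp add: field_simps)
      also have "\<dots> \<le> (1 + 1 / \<mu> x)\<^sup>2" using le_sq[of "1 / \<mu> x"] m by simp
      finally have "\<bar>f x\<bar> \<le> \<bar>1 + 1 / \<mu> x\<bar>" by (simp only: abs_le_square_iff)
      also have "\<dots> = 1 + 1 / \<mu> x" using m by simp
      finally show ?thesis by (auto simp: abs_le_iff)
    qed
    then show ?thesis using f by (auto simp: K_def B_def sq_norm_on_def)
  qed
  have unit: "sq_norm_on S \<mu> (\<lambda>x. (1 / sqrt (sq_norm_on S \<mu> g)) * g x) = 1"
    if "0 < sq_norm_on S \<mu> g" for g
    using that unfolding sq_norm_on_scale by (simp add: power_divide)
  obtain x0 where "x0 \<in> S" using ne by blast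
  then have "0 < sq_norm_on S \<mu> (\<lambda>_. 1)" using sq_norm_on_pos[OF fin pos] by auto
  then have "K \<noteq> {}" using inK unit by blast
  then obtain h where h: "h \<in> K" "\<And>f. f \<in> K \<Longrightarrow> kernel_form S p \<mu> f f \<le> kernel_form S p \<mu> h h"
    using continuous_attains_sup[OF cK _ continuous_on_subset[OF ck]] by blast
  have unit_le: "kernel_form S p \<mu> f f \<le> kernel_form S p \<mu> h h" if "sq_norm_on S \<mu> f = 1" for f
    using h(2)[OF inK[OF that]] by (simp add: kernel_form_def)
  have "kernel_form S p \<mu> g g \<le> kernel_form S p \<mu> h h * sq_norm_on S \<mu> g" for g
  proof (cases "\<exists>x\<in>S. g x \<noteq> 0")
    case True
    then have q: "0 < sq_norm_on S \<mu> g" using sq_norm_on_pos[of S \<mu> _ g] fin pos by blast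
    have "kernel_form S p \<mu> g g / sq_norm_on S \<mu> g
      = kernel_form S p \<mu> (\<lambda>x. (1 / sqrt (sq_norm_on S \<mu> g)) * g x)
          (\<lambda>x. (1 / sqrt (sq_norm_on S \<mu> g)) * g x)"
      using q unfolding kernel_form_scale by (simp add: power_divide)
    also have "\<dots> \<le> kernel_form S p \<mu> h h" by (rule unit_le[OF unit[OF q]])
    finally show ?thesis using q by (simp add: field_simps)
  next
    case False
    then show ?thesis by (simp add: kernel_form_def sq_norm_on_def)
  qed
  moreover have "sq_norm_on S \<mu> h = 1" using h(1) by (simp add: K_def)
  ultimately show thesis using that by blast
qed

text \<open>Near 0 the linear term dominates: with d = |b| + 1 > b, the polynomial would be negative
  at t = -a / d.\<close>

lemma linear_coeff_zero:
  fixes a b :: real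
  assumes "\<And>t. 0 \<le> a * t + b * t\<^sup>2"
  shows "a = 0"
proof (rule ccontr)
  assume a: "a \<noteq> 0"
  define d where "d = \<bar>b\<bar> + 1"
  have d: "0 < d" by (simp add: d_def)
  have "a * (- a / d) + b * (- a / d)\<^sup>2 = (a / d)\<^sup>2 * (b - d)"
    using d by (simp add: field_simps power2_eq_square)
  also have "\<dots> < 0" using a d by (intro mult_pos_neg) (auto simp: d_def)
  finally show False using assms[of "- a / d"] by linarith
qed

section \<open>The spectral radius as the largest Rayleigh quotient\<close>

lemma spectral_radius_kernel_mat:
  assumes "finite S" "S \<noteq> {}"
  shows "spectral_radius (kernel_mat S p) \<in> norm ` Collect (eigenvalue (kernel_mat S p))"
    "eigenvalue (kernel_mat S p) k \<Longrightarrow> norm k \<le> spectral_radius (kernel_mat S p)"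
proof -
  have A: "kernel_mat S p \<in> carrier_mat (card S) (card S)" by (simp add: kernel_mat_def)
  have n: "0 < card S" using assms by (simp add: card_gt_0_iff)
  show "spectral_radius (kernel_mat S p) \<in> norm ` Collect (eigenvalue (kernel_mat S p))"
    using spectral_radius_mem_max(1)[OF A n] by (simp add: spectrum_def)
  show "norm k \<le> spectral_radius (kernel_mat S p)" if "eigenvalue (kernel_mat S p) k"
    using that by (intro spectral_radius_mem_max(2)[OF A n]) (auto simp: spectrum_def)
qed

text \<open>A maximizer of the Rayleigh quotient is an eigenvector, by the first-order condition.\<close>

lemma kernel_form_le_spectral_radius:
  assumes fin: "finite S" and ne: "S \<noteq> {}" and pos: "\<And>x. x \<in> S \<Longrightarrow> 0 < \<mu> x"
    and rev: "reversible_wrt S p \<mu>"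
  shows "kernel_form S p \<mu> g g \<le> spectral_radius (kernel_mat S p) * sq_norm_on S \<mu> g"
proof -
  obtain h where h: "sq_norm_on S \<mu> h = 1"
    and hmax: "\<And>g. kernel_form S p \<mu> g g \<le> kernel_form S p \<mu> h h * sq_norm_on S \<mu> g"
    using rayleigh_maximizer[of S \<mu> p, OF fin ne pos] by blast
  define M where "M = kernel_form S p \<mu> h h"
  have eig: "(\<Sum>y\<in>S. p x y * h y) = M * h x" if x: "x \<in> S" for x
  proof -
    \<comment> \<open>Perturbing the maximizer \<open>h\<close> at the single state \<open>x\<close>
      yields row \<open>x\<close> of the eigenvalue equation. The terms constant in \<open>t\<close>
      cancel because \<open>h\<close> has norm 1.\<close>
    define g where "g = (\<lambda>y. if y = x then 1 else 0 :: real)"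
    have "0 \<le> 2 * (M * (\<Sum>x\<in>S. \<mu> x * g x * h x) - kernel_form S p \<mu> g h) * t
      + (M * sq_norm_on S \<mu> g - kernel_form S p \<mu> g g) * t\<^sup>2" for t
      using hmax[of "\<lambda>x. h x + t * g x", unfolded kernel_form_perturb[OF rev] sq_norm_on_perturb h,
          folded M_def]
      by (simp add: algebra_simps)
    from linear_coeff_zero[OF this]
    have "M * (\<Sum>x\<in>S. \<mu> x * g x * h x) = kernel_form S p \<mu> g h" by simp
    moreover have "(\<Sum>x\<in>S. \<mu> x * g x * h x) = \<mu> x * h x"
      using x fin by (simp add: g_def if_distrib if_distribR sum.delta cong: if_cong)
    moreover have "kernel_form S p \<mu> g h = (\<Sum>z\<in>S. if z = x then \<mu> x * (\<Sum>y\<in>S. p x y * h y) else 0)"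
      unfolding kernel_form_def g_def
      by (intro sum.cong refl) (auto simp: sum_distrib_left mult_ac)
    ultimately have "\<mu> x * (M * h x) = \<mu> x * (\<Sum>y\<in>S. p x y * h y)"
      using x fin by (simp add: mult_ac)
    then show ?thesis using pos[OF x] by simp
  qed
  have "\<exists>x\<in>S. h x \<noteq> 0"
  proof (rule ccontr)
    assume "\<not> ?thesis"
    then have "sq_norm_on S \<mu> h = 0" by (simp add: sq_norm_on_def)
    then show False using h by simp
  qed
  then have "eigenvalue (kernel_mat S p) (complex_of_real M)"
    unfolding eigenvalue_kernel_mat[OF fin]
    by (intro exI[of _ "\<lambda>x. complex_of_real (h x)"])
      (simp flip: of_real_mult of_real_sum add: eig)
  \<comment> \<open>The sign of \<open>M\<close> is not known here; the radius bounds its modulus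
    and therefore \<open>M\<close> itself.\<close>
  then have "\<bar>M\<bar> \<le> spectral_radius (kernel_mat S p)"
    using spectral_radius_kernel_mat(2)[OF fin ne] by fastforce
  then have "M * sq_norm_on S \<mu> g \<le> spectral_radius (kernel_mat S p) * sq_norm_on S \<mu> g"
    using pos by (intro mult_right_mono sq_norm_on_nonneg) (auto simp: less_imp_le)
  then show ?thesis using hmax[of g] by (simp add: M_def)
qed

text \<open>Passing to the modulus of an eigenvector can only increase the kernel form.\<close>

lemma spectral_radius_le_kernel_form:
  assumes fin: "finite S" and ne: "S \<noteq> {}" and pos: "\<And>x. x \<in> S \<Longrightarrow> 0 < \<mu> x"
    and nonneg: "\<And>x y. x \<in> S \<Longrightarrow> y \<in> S \<Longrightarrow> 0 \<le> p x y"
  obtains h where "0 < sq_norm_on S \<mu> h"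
    "spectral_radius (kernel_mat S p) * sq_norm_on S \<mu> h \<le> kernel_form S p \<mu> h h"
proof -
  obtain k where k: "eigenvalue (kernel_mat S p) k" "spectral_radius (kernel_mat S p) = norm k"
    using spectral_radius_kernel_mat(1)[OF fin ne, of p] by auto
  obtain f x0 where f: "x0 \<in> S" "f x0 \<noteq> 0"
    "\<And>x. x \<in> S \<Longrightarrow> (\<Sum>y\<in>S. complex_of_real (p x y) * f y) = k * f x"
    using k(1) unfolding eigenvalue_kernel_mat[OF fin] by blast
  define h where "h = (\<lambda>x. norm (f x))"
  \<comment> \<open>The eigenvalue and the eigenvector may be complex. For a nonnegative kernel the
    triangle inequality turns their equation into an inequality between real functions, which is
    then summed against the nonnegative weights \<open>\<mu> x * h x\<close>.\<close>
  have le: "norm k * h x \<le> (\<Sum>y\<in>S. p x y * h y)" if x: "x \<in> S" for x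
  proof -
    have "norm k * h x = norm (\<Sum>y\<in>S. complex_of_real (p x y) * f y)"
      by (simp add: f(3)[OF x] h_def norm_mult)
    also have "\<dots> \<le> (\<Sum>y\<in>S. norm (complex_of_real (p x y) * f y))" by (rule norm_sum)
    also have "\<dots> = (\<Sum>y\<in>S. p x y * h y)"
      using nonneg[OF x] by (intro sum.cong refl) (simp add: norm_mult h_def)
    finally show ?thesis .
  qed
  have "norm k * sq_norm_on S \<mu> h = (\<Sum>x\<in>S. \<mu> x * h x * (norm k * h x))"
    by (simp add: sq_norm_on_def sum_distrib_left power2_eq_square mult_ac)
  also have "\<dots> \<le> (\<Sum>x\<in>S. \<mu> x * h x * (\<Sum>y\<in>S. p x y * h y))"
    using pos by (intro sum_mono mult_left_mono le) (auto simp: h_def less_imp_le)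
  also have "\<dots> = kernel_form S p \<mu> h h"
    by (simp add: kernel_form_def sum_distrib_left mult_ac)
  finally show thesis
    using that[of h] sq_norm_on_pos[of S \<mu> x0 h] fin pos f(1,2) k(2) by (simp add: h_def)
qed

section \<open>Dirichlet forms, the Poincare inequality and positivity of the spectral gap\<close>

lemma dirichlet_form_nonneg:
  assumes "\<And>x y. x \<in> S \<Longrightarrow> y \<in> S \<Longrightarrow> 0 \<le> q x y" "\<And>x. x \<in> S \<Longrightarrow> 0 \<le> w x"
  shows "0 \<le> dirichlet_form S q w f"
  unfolding dirichlet_form_def using assms by (auto intro!: sum_nonneg)

lemma edge_le_dirichlet_form:
  assumes fin: "finite S" and q: "\<And>x y. x \<in> S \<Longrightarrow> y \<in> S \<Longrightarrow> 0 \<le> q x y"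
    and w: "\<And>x. x \<in> S \<Longrightarrow> 0 \<le> w x" and ab: "a \<in> S" "b \<in> S"
  shows "w a * q a b * (f a - f b)\<^sup>2 \<le> 2 * dirichlet_form S q w f"
proof -
  have nn: "0 \<le> w x * q x y * (f x - f y)\<^sup>2" if "x \<in> S" "y \<in> S" for x y
    using that q w by simp
  have "w a * q a b * (f a - f b)\<^sup>2 \<le> (\<Sum>y\<in>S. w a * q a y * (f a - f y)\<^sup>2)"
    using fin ab nn by (intro member_le_sum) auto
  also have "\<dots> \<le> (\<Sum>x\<in>S. \<Sum>y\<in>S. w x * q x y * (f x - f y)\<^sup>2)"
    using fin ab nn by (intro member_le_sum[of a S "\<lambda>x. \<Sum>y\<in>S. w x * q x y * (f x - f y)\<^sup>2"])
      (auto intro!: sum_nonneg)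
  finally show ?thesis by (simp add: dirichlet_form_def)
qed

text \<open>The energy controls the increment of \<open>f\<close> across each edge of positive
  weight, and the triangle inequality adds these bounds along a path. The constant is chosen before
  \<open>f\<close>, as a uniform Poincare constant requires.\<close>

lemma dirichlet_path_bound:
  assumes fin: "finite S" and q: "\<And>x y. x \<in> S \<Longrightarrow> y \<in> S \<Longrightarrow> 0 \<le> q x y"
    and w: "\<And>x. x \<in> S \<Longrightarrow> 0 < w x"
    and xy: "(x, y) \<in> {(a, b). a \<in> S \<and> b \<in> S \<and> 0 < q a b}\<^sup>*"
  shows "\<exists>K\<ge>0. \<forall>f. \<bar>f x - f y\<bar> \<le> K * sqrt (dirichlet_form S q w f)"
  using xy
proof (induction rule: rtrancl_induct)
  case base
  then show ?case by (intro exI[of _ 0]) simp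
next
  case (step y z)
  then obtain K where K: "0 \<le> K" "\<And>f. \<bar>f x - f y\<bar> \<le> K * sqrt (dirichlet_form S q w f)"
    by blast
  define c where "c = w y * q y z"
  have yz: "y \<in> S" "z \<in> S" and c: "0 < c" using step w by (auto simp: c_def)
  have "\<bar>f y - f z\<bar> \<le> sqrt (2 / c) * sqrt (dirichlet_form S q w f)" for f
  proof -
    have "c * (f y - f z)\<^sup>2 \<le> 2 * dirichlet_form S q w f"
      using edge_le_dirichlet_form[of S q w y z f] fin q yz w by (simp add: c_def less_imp_le)
    then have "(f y - f z)\<^sup>2 \<le> 2 / c * dirichlet_form S q w f" using c by (simp add: field_simps)
    then have "sqrt ((f y - f z)\<^sup>2) \<le> sqrt (2 / c * dirichlet_form S q w f)"
      by (rule real_sqrt_le_mono)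
    then show ?thesis by (simp only: real_sqrt_abs real_sqrt_mult)
  qed
  then have "\<bar>f x - f z\<bar> \<le> (K + sqrt (2 / c)) * sqrt (dirichlet_form S q w f)" for f
    using K(2)[of f] by (smt (verit) distrib_right)
  moreover have "0 \<le> K + sqrt (2 / c)" using K(1) c by simp
  ultimately show ?case by blast
qed

text \<open>By irreducibility any two states are joined by a path, so the oscillation of
  \<open>f\<close> is at most a constant times the square root of the energy. The deviation from the
  mean is an average of differences and obeys the same bound.\<close>

lemma poincare_inequality:
  assumes fin: "finite S" and q: "\<And>x y. x \<in> S \<Longrightarrow> y \<in> S \<Longrightarrow> 0 \<le> q x y"
    and w: "\<And>x. x \<in> S \<Longrightarrow> 0 < w x" and w1: "(\<Sum>x\<in>S. w x) = 1"
    and irr: "irreducible_on S q"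
  obtains c where "0 < c" "\<And>f. c * variance_on S w f \<le> dirichlet_form S q w f"
proof -
  have "\<forall>x\<in>S. \<forall>y\<in>S. \<exists>K\<ge>0. \<forall>f. \<bar>f x - f y\<bar> \<le> K * sqrt (dirichlet_form S q w f)"
    using dirichlet_path_bound[of S q w, OF fin q w] irr unfolding irreducible_on_def by blast
  then obtain K where K: "\<And>x y. x \<in> S \<Longrightarrow> y \<in> S \<Longrightarrow> 0 \<le> K x y"
    "\<And>x y f. x \<in> S \<Longrightarrow> y \<in> S \<Longrightarrow> \<bar>f x - f y\<bar> \<le> K x y * sqrt (dirichlet_form S q w f)"
    by metis
  \<comment> \<open>The sum dominates every \<open>K x y\<close>; the extra 1 keeps \<open>L\<close>
    positive for the later division.\<close>
  define L where "L = 1 + (\<Sum>x\<in>S. \<Sum>y\<in>S. K x y)"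
  have L: "0 < L" unfolding L_def using K(1) by (intro add_pos_nonneg sum_nonneg) auto
  have KL: "K x y \<le> L" if "x \<in> S" "y \<in> S" for x y
  proof -
    have "K x y \<le> (\<Sum>y\<in>S. K x y)" using fin that K(1) by (intro member_le_sum) auto
    also have "\<dots> \<le> (\<Sum>x\<in>S. \<Sum>y\<in>S. K x y)"
      using fin that K(1) by (intro member_le_sum[of x S "\<lambda>x. \<Sum>y\<in>S. K x y"]) (auto intro!: sum_nonneg)
    finally show ?thesis by (simp add: L_def)
  qed
  have "variance_on S w f \<le> L\<^sup>2 * dirichlet_form S q w f" for f
  proof -
    let ?D = "dirichlet_form S q w f"
    have D: "0 \<le> ?D" using dirichlet_form_nonneg[of S q w f] q w by (simp add: less_imp_le)
    have osc: "\<bar>f x - f y\<bar> \<le> L * sqrt ?D" if "x \<in> S" "y \<in> S" for x y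
      using K(2)[OF that, of f] mult_right_mono[OF KL[OF that], of "sqrt ?D"] D by simp
    have "(f x - mean_on S w f)\<^sup>2 \<le> L\<^sup>2 * ?D" if x: "x \<in> S" for x
    proof -
      have "f x - mean_on S w f = (\<Sum>y\<in>S. w y * (f x - f y))"
        using w1 by (simp add: mean_on_def right_diff_distrib sum_subtractf flip: sum_distrib_right)
      also have "\<bar>\<dots>\<bar> \<le> (\<Sum>y\<in>S. \<bar>w y * (f x - f y)\<bar>)" by (rule sum_abs)
      also have "\<dots> \<le> (\<Sum>y\<in>S. w y * (L * sqrt ?D))"
        using w osc[OF x] by (intro sum_mono) (simp add: abs_mult less_imp_le)
      also have "\<dots> = L * sqrt ?D" using w1 by (simp flip: sum_distrib_right)
      finally have "(f x - mean_on S w f)\<^sup>2 \<le> (L * sqrt ?D)\<^sup>2"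
        by (metis abs_ge_zero power2_abs power_mono)
      then show ?thesis using D by (simp add: power_mult_distrib)
    qed
    then have "variance_on S w f \<le> (\<Sum>x\<in>S. w x * (L\<^sup>2 * ?D))"
      unfolding variance_on_def mean_on_def[of S w "\<lambda>x. (f x - mean_on S w f)\<^sup>2"]
      using w by (intro sum_mono mult_left_mono) (auto simp: less_imp_le)
    also have "\<dots> = L\<^sup>2 * ?D" using w1 by (simp flip: sum_distrib_right)
    finally show ?thesis .
  qed
  then have "1 / L\<^sup>2 * variance_on S w f \<le> dirichlet_form S q w f" for f
    using L by (simp add: field_simps)
  then show thesis using that[of "1 / L\<^sup>2"] L by simp
qed

lemma variance_on_nonneg:
  assumes "\<And>x. x \<in> S \<Longrightarrow> 0 \<le> w x"
  shows "0 \<le> variance_on S w f"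
  unfolding variance_on_def mean_on_def[of S w "\<lambda>x. (f x - mean_on S w f)\<^sup>2"]
  using assms by (intro sum_nonneg) auto

lemma variance_on_eq:
  assumes "(\<Sum>x\<in>S. w x) = 1"
  shows "variance_on S w f = sq_norm_on S w f - (mean_on S w f)\<^sup>2"
proof -
  define m where "m = mean_on S w f"
  have "variance_on S w f = (\<Sum>x\<in>S. w x * (f x)\<^sup>2 - 2 * m * (w x * f x) + m\<^sup>2 * w x)"
    unfolding variance_on_def m_def[symmetric] mean_on_def[of S w "\<lambda>x. (f x - m)\<^sup>2"]
    by (intro sum.cong refl) (simp add: power2_diff algebra_simps)
  also have "\<dots> = sq_norm_on S w f - 2 * m * mean_on S w f + m\<^sup>2 * (\<Sum>x\<in>S. w x)"
    by (simp add: sq_norm_on_def mean_on_def sum.distrib sum_subtractf sum_distrib_left)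
  finally show ?thesis using assms by (simp add: m_def power2_eq_square)
qed

text \<open>The Poincare constant is a lower bound for all quotients. Two distinct states give an
  indicator function of nonzero variance, so the infimum is taken over a nonempty set.\<close>

lemma spectral_gap_pos:
  assumes fin: "finite S" and two: "2 \<le> card S"
    and q: "\<And>x y. x \<in> S \<Longrightarrow> y \<in> S \<Longrightarrow> 0 \<le> q x y"
    and w: "\<And>x. x \<in> S \<Longrightarrow> 0 < w x" and w1: "(\<Sum>x\<in>S. w x) = 1"
    and irr: "irreducible_on S q"
  shows "0 < spectral_gap S q w"
proof -
  obtain c where c: "0 < c" "\<And>f. c * variance_on S w f \<le> dirichlet_form S q w f"
    using poincare_inequality[OF fin q w w1 irr] by blast
  obtain a b where ab: "a \<in> S" "b \<in> S" "a \<noteq> b"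
    using two by (metis card_le_Suc0_iff_eq fin not_less_eq_eq numeral_2_eq_2)
  define f where "f = (\<lambda>x. if x = a then 1 else 0 :: real)"
  have "variance_on S w f \<noteq> 0"
  proof
    assume "variance_on S w f = 0"
    then have "\<forall>x\<in>S. w x * (f x - mean_on S w f)\<^sup>2 = 0"
      unfolding variance_on_def mean_on_def[of S w "\<lambda>x. (f x - mean_on S w f)\<^sup>2"]
      using fin w by (subst (asm) sum_nonneg_eq_0_iff) (auto simp: less_imp_le)
    then have "\<forall>x\<in>S. f x = mean_on S w f" using w by fastforce
    then have "f a = f b" using ab by metis
    then show False using ab by (simp add: f_def)
  qed
  then have "{dirichlet_form S q w f / variance_on S w f | f. variance_on S w f \<noteq> 0} \<noteq> {}"
    by blast
  moreover have "c \<le> r"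
    if r: "r \<in> {dirichlet_form S q w f / variance_on S w f | f. variance_on S w f \<noteq> 0}" for r
  proof -
    obtain f where f: "r = dirichlet_form S q w f / variance_on S w f" "variance_on S w f \<noteq> 0"
      using r by blast
    then have "0 < variance_on S w f" using variance_on_nonneg[of S w f] w by (simp add: less_imp_le)
    then show ?thesis using c(2)[of f] f(1) by (simp add: pos_le_divide_eq)
  qed
  ultimately have "c \<le> spectral_gap S q w" unfolding spectral_gap_def by (intro cInf_greatest)
  then show ?thesis using c(1) by simp
qed

text \<open>The product form also covers functions of zero variance, which the infimum excludes; for
  them nonnegativity of the energy suffices.\<close>

lemma spectral_gap_variance_le:
  assumes q: "\<And>x y. x \<in> S \<Longrightarrow> y \<in> S \<Longrightarrow> 0 \<le> q x y"
    and w: "\<And>x. x \<in> S \<Longrightarrow> 0 \<le> w x"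
  shows "spectral_gap S q w * variance_on S w f \<le> dirichlet_form S q w f"
proof (cases "variance_on S w f = 0")
  case True
  then show ?thesis using dirichlet_form_nonneg[of S q w f] q w by simp
next
  case False
  then have v: "0 < variance_on S w f" using variance_on_nonneg[of S w f] w by simp
  have "spectral_gap S q w \<le> dirichlet_form S q w f / variance_on S w f"
    unfolding spectral_gap_def
  proof (rule cInf_lower)
    show "bdd_below {dirichlet_form S q w f / variance_on S w f | f. variance_on S w f \<noteq> 0}"
      using dirichlet_form_nonneg[of S q w] variance_on_nonneg[of S w] q w
      by (intro bdd_belowI[of _ 0]) auto
  qed (use False in blast)
  then show ?thesis using v by (simp add: field_simps)
qed

section \<open>Reversible kernels and restriction to a subset\<close>

lemma reversible_weights_pos:
  assumes "markov_kernel X p" "irreducible_on X p" "prob_weights X \<mu>" "reversible_wrt X p \<mu>"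
    and y: "y \<in> X"
  shows "0 < \<mu> y"
proof -
  have "\<exists>x\<in>X. \<mu> x \<noteq> 0"
    using assms(3) unfolding prob_weights_def by (metis sum.neutral zero_neq_one)
  then obtain x where x: "x \<in> X" "0 < \<mu> x" using assms(3) by (force simp: prob_weights_def)
  have "(x, y) \<in> {(a, b). a \<in> X \<and> b \<in> X \<and> 0 < p a b}\<^sup>*"
    using assms(2) x y by (simp add: irreducible_on_def)
  then show ?thesis
  proof (induction rule: rtrancl_induct)
    case base
    then show ?case by (rule x)
  next
    case (step a b)
    then have ab: "a \<in> X" "b \<in> X" "0 < p a b" by auto
    \<comment> \<open>Detailed balance carries positivity of \<mu> across an edge, and
      irreducibility reaches every state from one of positive weight.\<close>
    then have "0 < \<mu> b * p b a"
      using step.IH assms(4) by (metis reversible_wrt_def mult_pos_pos)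
    moreover have "0 \<le> p b a" using assms(1) ab by (simp add: markov_kernel_def)
    ultimately show ?case by (simp add: zero_less_mult_iff)
  qed
qed

text \<open>Expand the square. One diagonal term is the norm because rows sum to 1, and the other
  equals it by reversibility.\<close>

lemma dirichlet_form_eq:
  assumes "markov_kernel X p" "reversible_wrt X p \<mu>"
  shows "dirichlet_form X p \<mu> f = sq_norm_on X \<mu> f - kernel_form X p \<mu> f f"
proof -
  have row: "(\<Sum>x\<in>X. \<Sum>y\<in>X. \<mu> x * p x y * (f x)\<^sup>2) = sq_norm_on X \<mu> f"
    unfolding sq_norm_on_def
  proof (intro sum.cong refl)
    fix x assume "x \<in> X"
    then have "(\<Sum>y\<in>X. p x y) = 1" using assms(1) by (simp add: markov_kernel_def)
    then show "(\<Sum>y\<in>X. \<mu> x * p x y * (f x)\<^sup>2) = \<mu> x * (f x)\<^sup>2"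
      by (simp flip: sum_distrib_left sum_distrib_right)
  qed
  have "(\<Sum>x\<in>X. \<Sum>y\<in>X. \<mu> x * p x y * (f y)\<^sup>2) = (\<Sum>y\<in>X. \<Sum>x\<in>X. \<mu> x * p x y * (f y)\<^sup>2)"
    by (rule sum.swap)
  also have "\<dots> = (\<Sum>y\<in>X. \<Sum>x\<in>X. \<mu> y * p y x * (f y)\<^sup>2)"
    using assms(2) by (intro sum.cong refl) (simp add: reversible_wrt_def)
  finally have col: "(\<Sum>x\<in>X. \<Sum>y\<in>X. \<mu> x * p x y * (f y)\<^sup>2) = sq_norm_on X \<mu> f"
    by (simp add: row)
  have "(\<Sum>x\<in>X. \<Sum>y\<in>X. \<mu> x * p x y * (f x - f y)\<^sup>2)
    = (\<Sum>x\<in>X. \<Sum>y\<in>X. \<mu> x * p x y * (f x)\<^sup>2) + (\<Sum>x\<in>X. \<Sum>y\<in>X. \<mu> x * p x y * (f y)\<^sup>2)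
      - 2 * kernel_form X p \<mu> f f"
    unfolding kernel_form_def sum_distrib_left sum.distrib[symmetric] sum_subtractf[symmetric]
    by (intro sum.cong refl) (simp add: power2_diff algebra_simps)
  then show ?thesis by (simp add: dirichlet_form_def row col)
qed

text \<open>For functions vanishing outside \<open>R\<close> the energy is the quadratic form of the
  identity minus the sub-Markovian block on \<open>R\<close>. This links the energy to
  \<open>phi_star\<close>.\<close>

lemma dirichlet_form_supported:
  assumes "finite X" "markov_kernel X p" "reversible_wrt X p \<mu>" "R \<subseteq> X"
    and f: "\<forall>x\<in>X - R. f x = 0"
  shows "dirichlet_form X p \<mu> f = sq_norm_on R \<mu> f - kernel_form R p \<mu> f f"
proof -
  have "sq_norm_on X \<mu> f = sq_norm_on R \<mu> f"
    unfolding sq_norm_on_def using assms by (intro sum.mono_neutral_right) auto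
  moreover have "kernel_form X p \<mu> f f = (\<Sum>x\<in>R. \<Sum>y\<in>X. \<mu> x * p x y * f x * f y)"
    unfolding kernel_form_def using assms by (intro sum.mono_neutral_right) auto
  moreover have "\<dots> = kernel_form R p \<mu> f f"
    unfolding kernel_form_def using assms by (intro sum.cong refl sum.mono_neutral_right) auto
  ultimately show ?thesis using dirichlet_form_eq[OF assms(2,3)] by simp
qed

text \<open>The escape mass added on the diagonal multiplies \<open>(f x - f x)\<^sup>2\<close> = 0,
  so restricting only discards nonnegative terms. Conditioning accounts for the division by
  \<mu>(R).\<close>

lemma dirichlet_form_restricted_le:
  assumes "finite X" "R \<subseteq> X" and p: "\<And>x y. x \<in> X \<Longrightarrow> y \<in> X \<Longrightarrow> 0 \<le> p x y"
    and \<mu>: "\<And>x. x \<in> X \<Longrightarrow> 0 \<le> \<mu> x"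
  shows "dirichlet_form R (restricted_kernel X p R) (cond_weights \<mu> R) f
    \<le> dirichlet_form X p \<mu> f / (\<Sum>a\<in>R. \<mu> a)"
proof -
  let ?m = "\<Sum>a\<in>R. \<mu> a"
  have m: "0 \<le> ?m" using assms by (intro sum_nonneg) auto
  have "dirichlet_form R (restricted_kernel X p R) (cond_weights \<mu> R) f
    = 1 / 2 * (\<Sum>x\<in>R. \<Sum>y\<in>R. \<mu> x * p x y * (f x - f y)\<^sup>2) / ?m"
    unfolding dirichlet_form_def sum_divide_distrib sum_distrib_left
    by (intro sum.cong refl) (auto simp: restricted_kernel_def cond_weights_def)
  also have "(\<Sum>x\<in>R. \<Sum>y\<in>R. \<mu> x * p x y * (f x - f y)\<^sup>2)
    \<le> (\<Sum>x\<in>R. \<Sum>y\<in>X. \<mu> x * p x y * (f x - f y)\<^sup>2)"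
    using assms by (intro sum_mono sum_mono2) auto
  also have "\<dots> \<le> (\<Sum>x\<in>X. \<Sum>y\<in>X. \<mu> x * p x y * (f x - f y)\<^sup>2)"
    using assms by (intro sum_mono2) (auto intro!: sum_nonneg)
  finally show ?thesis using m by (simp add: dirichlet_form_def divide_right_mono)
qed

section \<open>The capacity and the two bounds\<close>

theorem theorem2p9:
  fixes X R :: "'a set" and p :: "'a \<Rightarrow> 'a \<Rightarrow> real" and \<mu> :: "'a \<Rightarrow> real" and \<kappa> :: real
  assumes "finite X"
    and "markov_kernel X p"
    and "irreducible_on X p"
    and "prob_weights X \<mu>"
    and "reversible_wrt X p \<mu>"
    and "R \<subset> X"
    and "card R \<ge> 2"
    and "irreducible_on R (restricted_kernel X p R)"
    and "irreducible_on (X - R) (restricted_kernel X p (X - R))"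
    and "\<kappa> > 0"
  shows "kappa_capacity X p \<mu> \<kappa> R / (\<Sum>a\<in>R. \<mu> a)
           * (1 - eps_star X p \<mu> R - \<kappa> / restricted_gap X p \<mu> R)
         \<le> phi_star p R
       \<and> phi_star p R
         \<le> kappa_capacity X p \<mu> \<kappa> R / (\<Sum>a\<in>R. \<mu> a)
           * (1 - kappa_capacity X p \<mu> \<kappa> R / (\<kappa> * (\<Sum>a\<in>R. \<mu> a))) powi (-2)"
proof -
  note mk = assms(2) and rev = assms(5) and \<kappa> = assms(10)
  have finR: "finite R" and RX: "R \<subseteq> X" and neR: "R \<noteq> {}"
    using assms(1,6,7) by (auto intro: finite_subset)
  have \<mu>X: "0 < \<mu> x" if "x \<in> X" for x
    by (rule reversible_weights_pos[OF assms(2-5) that])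
  have \<mu>: "0 < \<mu> x" if "x \<in> R" for x using \<mu>X RX that by blast
  have pX: "0 \<le> p x y" if "x \<in> X" "y \<in> X" for x y
    using mk that by (simp add: markov_kernel_def)
  have revR: "reversible_wrt R p \<mu>" using rev RX by (auto simp: reversible_wrt_def)
  define m where "m = (\<Sum>a\<in>R. \<mu> a)"
  define w where "w = cond_weights \<mu> R"
  define q where "q = restricted_kernel X p R"
  define D where "D = dirichlet_form X p \<mu>"
  define c where "c = kappa_capacity X p \<mu> \<kappa> R / m"
  define \<phi> where "\<phi> = phi_star p R"
  define \<gamma> where "\<gamma> = restricted_gap X p \<mu> R"
  have m: "0 < m" unfolding m_def using finR neR \<mu> by (intro sum_pos)
  have w: "0 < w x" if "x \<in> R" for x using m \<mu> that by (simp add: w_def cond_weights_def m_def)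
  have w1: "(\<Sum>x\<in>R. w x) = 1"
    using m by (simp add: w_def cond_weights_def m_def flip: sum_divide_distrib)
  have q: "0 \<le> q x y" if "x \<in> R" "y \<in> R" for x y
    using that RX pX by (auto simp: q_def restricted_kernel_def escape_prob_def intro!: add_nonneg_nonneg sum_nonneg)
  have \<gamma>: "0 < \<gamma>"
    unfolding \<gamma>_def restricted_gap_def w_def[symmetric] q_def[symmetric]
    using spectral_gap_pos[OF finR assms(7) q w w1] assms(8) by (simp add: q_def)
  have Dnn: "0 \<le> D f" for f
    unfolding D_def using pX \<mu>X by (intro dirichlet_form_nonneg) (auto simp: less_imp_le)
  have gap: "\<gamma> * variance_on R w f \<le> D f / m" for f
  proof -
    have "\<gamma> * variance_on R w f \<le> dirichlet_form R q w f"
      unfolding \<gamma>_def restricted_gap_def w_def[symmetric] q_def[symmetric]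
      using q w by (intro spectral_gap_variance_le) (auto simp: less_imp_le)
    also have "\<dots> \<le> D f / m"
      unfolding q_def w_def D_def m_def
      using assms(1) RX pX \<mu>X by (intro dirichlet_form_restricted_le) (auto simp: less_imp_le)
    finally show ?thesis .
  qed
  have sq_cond: "sq_norm_on R \<mu> f = m * sq_norm_on R w f" for f
    using m by (simp add: sq_norm_on_def w_def cond_weights_def m_def sum_distrib_left)
  have mean_cond: "(\<Sum>x\<in>R. \<mu> x * f x) = m * mean_on R w f" for f
    using m by (simp add: mean_on_def w_def cond_weights_def m_def sum_distrib_left)
  have var: "variance_on R w f = sq_norm_on R w f - (mean_on R w f)\<^sup>2" for f
    by (rule variance_on_eq[OF w1])
  have varnn: "0 \<le> variance_on R w f" for f
    using w by (intro variance_on_nonneg) (simp add: less_imp_le)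
  have Dsupp: "D f = sq_norm_on R \<mu> f - kernel_form R p \<mu> f f" if "\<forall>x\<in>X - R. f x = 0" for f
    unfolding D_def by (rule dirichlet_form_supported[OF assms(1) mk rev RX that])

  \<comment> \<open>This bound and the function \<open>h\<close> obtained next together say that
    \<phi> is the minimum of the Rayleigh quotient, attained at \<open>h\<close>.\<close>
  have \<phi>_le: "\<phi> * sq_norm_on R w f \<le> D f / m" if "\<forall>x\<in>X - R. f x = 0" for f
  proof -
    have "\<phi> * sq_norm_on R \<mu> f \<le> D f"
      using kernel_form_le_spectral_radius[OF finR neR \<mu> revR, of f] Dsupp[OF that]
      by (simp add: \<phi>_def phi_star_def algebra_simps)
    then show ?thesis using m by (simp add: sq_cond field_simps)
  qed
  obtain h where h0: "\<forall>x\<in>X - R. h x = 0" and hpos: "0 < sq_norm_on R w h"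
    and hle: "D h / m \<le> \<phi> * sq_norm_on R w h"
  proof -
    have "0 \<le> p x y" if "x \<in> R" "y \<in> R" for x y using pX RX that by blast
    then obtain g where g: "0 < sq_norm_on R \<mu> g"
      "spectral_radius (kernel_mat R p) * sq_norm_on R \<mu> g \<le> kernel_form R p \<mu> g g"
      using spectral_radius_le_kernel_form[of R \<mu> p, OF finR neR \<mu>] by blast
    define h where "h = (\<lambda>x. if x \<in> R then g x else 0)"
    have hg: "sq_norm_on R \<mu> h = sq_norm_on R \<mu> g" "kernel_form R p \<mu> h h = kernel_form R p \<mu> g g"
      by (simp_all add: h_def sq_norm_on_def kernel_form_def)
    have h0: "\<forall>x\<in>X - R. h x = 0" by (simp add: h_def)
    have "D h \<le> \<phi> * sq_norm_on R \<mu> h"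
      using g(2) Dsupp[OF h0] by (simp add: \<phi>_def phi_star_def algebra_simps hg)
    then have "D h / m \<le> \<phi> * sq_norm_on R w h" using m by (simp add: sq_cond field_simps)
    moreover have "0 < sq_norm_on R w h" 
      using g(1)[folded hg(1)] m unfolding sq_cond by (simp add: zero_less_mult_iff)
    ultimately show thesis using that h0 by blast
  qed
  \<comment> \<open>The energy of \<open>h\<close> is nonnegative and its norm is positive, hence so
    is the sign of \<phi>: the spectral radius of the block is at most 1.\<close>
  have \<phi>0: "0 \<le> \<phi>"
  proof -
    have "0 \<le> D h / m" using Dnn m by simp
    then have "0 \<le> \<phi> * sq_norm_on R w h" using hle by linarith
    then show ?thesis using hpos by (simp add: zero_le_mult_iff)
  qed

  \<comment> \<open>\<open>J\<close> is the capacity functional divided by \<mu>(R). With the square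
    expanded, it depends on \<open>f\<close> only through its energy, its second moment and its mean
    under the conditioned measure.\<close>
  define J where "J f = D f / m + \<kappa> * (sq_norm_on R w f - 2 * mean_on R w f + 1)" for f
  have J: "D f + \<kappa> * (\<Sum>a\<in>R. \<mu> a * (f a - 1)\<^sup>2) = m * J f" for f
  proof -
    have "(\<Sum>a\<in>R. \<mu> a * (f a - 1)\<^sup>2) = (\<Sum>a\<in>R. \<mu> a * (f a)\<^sup>2 - 2 * (\<mu> a * f a) + \<mu> a)"
      by (intro sum.cong refl) (simp add: power2_diff algebra_simps)
    also have "\<dots> = sq_norm_on R \<mu> f - 2 * (\<Sum>a\<in>R. \<mu> a * f a) + m"
      by (simp add: sum.distrib sum_subtractf sum_distrib_left sq_norm_on_def m_def)
    also have "\<dots> = m * (sq_norm_on R w f - 2 * mean_on R w f + 1)"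
      by (simp only: sq_cond mean_cond) (simp add: algebra_simps)
    finally have "(\<Sum>a\<in>R. \<mu> a * (f a - 1)\<^sup>2) = m * (sq_norm_on R w f - 2 * mean_on R w f + 1)" .
    then show ?thesis using m by (simp add: J_def distrib_left mult.left_commute del: mult_cancel_left)
  qed
  have C: "kappa_capacity X p \<mu> \<kappa> R = Inf {m * J f | f. \<forall>x\<in>X - R. f x = 0}"
    unfolding kappa_capacity_def D_def[symmetric] J ..
  have Jnn: "0 \<le> m * J f" for f
    unfolding J[symmetric] using \<kappa> Dnn \<mu>
    by (intro add_nonneg_nonneg mult_nonneg_nonneg sum_nonneg) (auto simp: less_imp_le)
  \<comment> \<open>\<open>c_le\<close> and \<open>c_ge\<close> characterize \<open>c\<close> as the
    infimum of \<open>J\<close>, so no minimizer of \<open>J\<close> has to be constructed. The zero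
    function shows that the set is nonempty.\<close>
  have c_le: "c \<le> J f" if "\<forall>x\<in>X - R. f x = 0" for f
  proof -
    have "kappa_capacity X p \<mu> \<kappa> R \<le> m * J f" unfolding C
      by (rule cInf_lower) (use that Jnn in \<open>auto intro!: bdd_belowI[of _ 0]\<close>)
    then show ?thesis using m by (simp add: c_def field_simps)
  qed
  have c_ge: "b \<le> c" if "\<And>f. \<forall>x\<in>X - R. f x = 0 \<Longrightarrow> b \<le> J f" for b
  proof -
    have "m * b \<le> kappa_capacity X p \<mu> \<kappa> R" unfolding C
      by (rule cInf_greatest) (use that m in \<open>auto intro!: exI[of _ "\<lambda>_. 0"]\<close>)
    then show ?thesis using m by (simp add: c_def field_simps)
  qed
  have c0: "0 \<le> c" using c_ge[of 0] Jnn m by (simp add: zero_le_mult_iff)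

  have Dscale: "D (\<lambda>x. t * f x) = t\<^sup>2 * D f" for t f
    by (simp add: D_def dirichlet_form_def sum_distrib_left power_mult_distrib mult_ac flip: right_diff_distrib)
  have Jscale: "J (\<lambda>x. t * f x)
      = t\<^sup>2 * (D f / m) + \<kappa> * (t\<^sup>2 * sq_norm_on R w f - 2 * t * mean_on R w f + 1)" for t f
    unfolding J_def Dscale sq_norm_on_scale
    by (simp add: mean_on_def sum_distrib_left mult_ac)

  \<comment> \<open>This makes 1 - c / \<kappa> strictly positive, so that dividing by its square is
    legitimate. The zero function only gives c \<le> \<kappa>; a small enough multiple of the
    indicator of \<open>R\<close> does strictly better.\<close>
  have c\<kappa>: "c < \<kappa>"
  proof -
    define e where "e = (\<lambda>x. if x \<in> R then 1 else 0 :: real)"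
    define a where "a = D e / m"
    \<comment> \<open>This is the minimizer over t of a t^2 + \<kappa> (1 - t)^2.\<close>
    define t where "t = \<kappa> / (a + \<kappa>)"
    have a: "0 \<le> a" using Dnn m by (simp add: a_def)
    have "mean_on R w e = 1" "sq_norm_on R w e = 1"
      using w1 by (simp_all add: e_def mean_on_def sq_norm_on_def)
    then have "J (\<lambda>x. t * e x) = t\<^sup>2 * a + \<kappa> * (t\<^sup>2 - 2 * t + 1)"
      unfolding Jscale by (simp add: a_def)
    also have "\<dots> = \<kappa> - \<kappa> * t"
    proof -
      have "t * (a + \<kappa>) = \<kappa>" using a \<kappa> by (simp add: t_def)
      then have "t * (t * (a + \<kappa>)) = t * \<kappa>" by simp
      then show ?thesis by (simp add: power2_eq_square algebra_simps)
    qed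
    also have "\<dots> < \<kappa>" using a \<kappa> by (simp add: t_def)
    finally show ?thesis using c_le[of "\<lambda>x. t * e x"] by (simp add: e_def)
  qed

  have upper: "\<phi> * (1 - c / \<kappa>) \<le> c"
  proof -
    have "\<phi> * \<kappa> / (\<phi> + \<kappa>) \<le> J f" if f: "\<forall>x\<in>X - R. f x = 0" for f
    proof -
      define s where "s = mean_on R w f"
      have Q: "s\<^sup>2 \<le> sq_norm_on R w f" using varnn[of f] by (simp add: var s_def)
      have "\<phi> * \<kappa> / (\<phi> + \<kappa>) \<le> \<phi> * s\<^sup>2 + \<kappa> * (s\<^sup>2 - 2 * s + 1)"
      proof -
        \<comment> \<open>This square is exactly the difference of the two sides after
          multiplication by \<phi> + \<kappa>.\<close>
        have "0 \<le> (s * (\<phi> + \<kappa>) - \<kappa>)\<^sup>2" by simp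
        then show ?thesis using \<phi>0 \<kappa> by (simp add: field_simps power2_eq_square)
      qed
      also have "\<dots> \<le> \<phi> * sq_norm_on R w f + \<kappa> * (sq_norm_on R w f - 2 * s + 1)"
        using Q \<phi>0 \<kappa> by (intro add_mono mult_left_mono) auto
      also have "\<dots> \<le> J f" using \<phi>_le[OF f] by (simp add: J_def s_def)
      finally show ?thesis .
    qed
    then have "\<phi> * \<kappa> / (\<phi> + \<kappa>) \<le> c" by (rule c_ge)
    then show ?thesis using \<phi>0 \<kappa> by (simp add: field_simps)
  qed
  have "\<phi> \<le> c * (1 - c / \<kappa>) powi (-2)"
  proof -
    define u where "u = 1 - c / \<kappa>"
    have u: "0 < u" "u \<le> 1" using c\<kappa> \<kappa> c0 by (simp_all add: u_def)
    \<comment> \<open>Since 0 < u \<le> 1, passing from u to u^2 weakens the bound just proved to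
      the stated power -2.\<close>
    have "\<phi> * u\<^sup>2 \<le> \<phi> * u"
      using u \<phi>0 by (intro mult_left_mono) (auto simp: power2_eq_square mult_left_le)
    also have "\<dots> \<le> c" using upper by (simp add: u_def)
    finally have "\<phi> \<le> c / u\<^sup>2" using u by (simp add: field_simps)
    then show ?thesis by (simp add: u_def power_int_minus divide_inverse)
  qed

  moreover have "c * (1 - \<phi> / \<gamma> - \<kappa> / \<gamma>) \<le> \<phi>"
  \<comment> \<open>If the factor is nonpositive, the left side is at most 0 \<le> \<phi>. Otherwise
    its positivity gives \<epsilon> < 1 and allows multiplying inequalities by it.\<close>
  proof (cases "1 - \<phi> / \<gamma> - \<kappa> / \<gamma> \<le> 0")
    case True
    then show ?thesis using c0 \<phi>0 by (meson mult_nonneg_nonpos order_trans)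
  next
    case False
    \<comment> \<open>\<open>r\<close> is the second moment of \<open>h\<close> after scaling to
      mean 1; that the mean \<open>s\<close> is nonzero is proved below.\<close>
    define \<epsilon> k s Q r where "\<epsilon> = \<phi> / \<gamma>" and "k = \<kappa> / \<gamma>" and "s = mean_on R w h"
      and "Q = sq_norm_on R w h" and "r = Q / s\<^sup>2"
    have k: "0 < k" and \<epsilon>: "0 \<le> \<epsilon>" "0 < 1 - \<epsilon> - k"
      using False \<kappa> \<gamma> \<phi>0 by (simp_all add: k_def \<epsilon>_def)
    have \<phi>\<epsilon>: "\<phi> = \<gamma> * \<epsilon>" and \<kappa>k: "\<kappa> = \<gamma> * k" using \<gamma> by (simp_all add: \<epsilon>_def k_def)
    have Q: "0 < Q" using hpos by (simp add: Q_def)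
    \<comment> \<open>The spectral gap bounds \<gamma> times the variance of \<open>h\<close> by its
      normalized energy, which is at most \<phi> Q = \<gamma> \<epsilon> Q. Since \<epsilon> < 1,
      the mean of \<open>h\<close> cannot vanish.\<close>
    have "\<gamma> * (Q - s\<^sup>2) \<le> \<gamma> * (\<epsilon> * Q)"
      using gap[of h] hle by (simp add: var Q_def s_def \<phi>\<epsilon> mult_ac)
    then have "Q - s\<^sup>2 \<le> \<epsilon> * Q" using \<gamma> by simp
    then have sQ: "(1 - \<epsilon>) * Q \<le> s\<^sup>2" by (simp add: algebra_simps)
    have "0 < (1 - \<epsilon>) * Q" using Q k \<epsilon> by simp
    then have s: "0 < s\<^sup>2" using sQ by linarith
    have r: "0 \<le> r" "(1 - \<epsilon>) * r \<le> 1" using Q sQ s by (simp_all add: r_def field_simps)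
    have "c \<le> J (\<lambda>x. (1 / s) * h x)" using h0 by (intro c_le) simp
    also have "\<dots> = (D h / m) / s\<^sup>2 + \<kappa> * (r - 1)"
      using s unfolding Jscale by (simp add: r_def Q_def s_def[symmetric] power_divide)
    \<comment> \<open>The bound r - 1 \<le> \<epsilon> r rewrites (1 - \<epsilon>) r \<le> 1. In the
      next step the terms combine because \<kappa> \<epsilon> and \<phi> k both equal \<gamma>
      \<epsilon> k.\<close>
    also have "\<dots> \<le> \<phi> * Q / s\<^sup>2 + \<kappa> * (\<epsilon> * r)"
      using hle s r(2) \<kappa> by (intro add_mono divide_right_mono mult_left_mono) (auto simp: Q_def algebra_simps)
    also have "\<dots> = \<phi> * r * (1 + k)" by (simp add: r_def \<phi>\<epsilon> \<kappa>k algebra_simps add_divide_distrib)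
    finally have "c * (1 - \<epsilon> - k) \<le> \<phi> * r * (1 + k) * (1 - \<epsilon> - k)"
      using \<epsilon> by (intro mult_right_mono) auto
    \<comment> \<open>The -k in the factor compensates 1 + k up to the nonpositive remainder -k
      (\<epsilon> + k); what is left is controlled by (1 - \<epsilon>) r \<le> 1.\<close>
    also have "\<dots> = \<phi> * r * (1 - \<epsilon> - k * (\<epsilon> + k))" by (simp add: algebra_simps)
    also have "\<dots> \<le> \<phi> * r * (1 - \<epsilon>)"
      using \<phi>0 r(1) k \<epsilon> by (intro mult_left_mono) auto
    also have "\<dots> \<le> \<phi>" using mult_left_mono[OF r(2) \<phi>0] by (simp add: mult_ac)
    finally show ?thesis by (simp add: \<epsilon>_def k_def)
  qed
  moreover have "kappa_capacity X p \<mu> \<kappa> R / (\<kappa> * m) = c / \<kappa>" by (simp add: c_def mult.commute)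
  ultimately show ?thesis
    unfolding eps_star_def m_def[symmetric] \<phi>_def[symmetric] \<gamma>_def[symmetric] c_def[symmetric]
    by simp
qed

end
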